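(* Let $C$ be a cycle in the graph $G$, and let $\{Y_i\}_{1\le i\le k}\subseteq\{S_j\}$ be the squares contained in the interior of $C$. Then the union $\bigcup_i Y_i$ of the squares contained in the interior of $C$ is a plus connected component whose outermost boundary is $C$.
   Context: Tile $\mathbb{R}^2$ into unit squares $\{S_k\}_{k\ge 0}$ (disjoint except for shared edges and corners), with the origin being the centre of $S_0$. Two distinct squares are plus adjacent if they share an edge. A collection of squares is a plus connected component if any two of its squares are joined by a sequence of distinct squares of the collection in which consecutive squares are plus adjacent. $G$ is the graph whose vertices are the corners of the squares in $\{S_k\}$ and whose edges are the (unit length) edges of the squares in $\{S_k\}$. A cycle is a closed path of distinct edges without repeated vertices (a simple closed lattice polygon). A cycle divides the plane into a bounded region, its interior, and an unbounded region, its exterior. A square is contained in the interior (exterior) of a cycle if its open unit square lies in the interior (exterior) region. An edge lies in the interior (exterior) of a cycle if both of the squares of $\{S_k\}$ having it as an edge lie in the interior (exterior) of the cycle. For a collection $A$ of squares, let $G_A$ be the subgraph of $G$ formed by the corners and edges of the squares in $A$. An edge $e$ of $G_A$ is an outermost boundary edge of $A$ if for every cycle $C'$ in $G_A$, either $e$ is an edge of $C'$ or $e$ lies in the exterior of $C'$. The outermost boundary of $A$ is the set of all outermost boundary edges of $A$. *)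

theory Defs
  imports "HOL-Analysis.Analysis"
begin

type_synonym point = "real \<times> real"

text \<open>
  The squares of the tiling are indexed by their centres, which are exactly the points with
  integer coordinates; the pair \<open>(0, 0)\<close> is the square centred at the origin.
\<close>

type_synonym square = "int \<times> int"

definition open_square :: "square \<Rightarrow> point set" where
  "open_square q = (case q of (i, j) \<Rightarrow>
     box (of_int i - 1/2, of_int j - 1/2) (of_int i + 1/2, of_int j + 1/2))"

text \<open>
  An edge is represented by the set of its two endpoints. The segment it occupies in the plane
  is the convex hull of that set.
\<close>

type_synonym edge = "point set"

definition square_edges :: "square \<Rightarrow> edge set" where
  "square_edges q = (case q of (i, j) \<Rightarrow>
     let l = of_int i - 1/2; r = of_int i + 1/2; b = of_int j - 1/2; t = of_int j + 1/2
     in {{(l, b), (r, b)}, {(r, b), (r, t)}, {(r, t), (l, t)}, {(l, t), (l, b)}})"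

definition plus_adjacent :: "square \<Rightarrow> square \<Rightarrow> bool" where
  "plus_adjacent q r \<longleftrightarrow> q \<noteq> r \<and> square_edges q \<inter> square_edges r \<noteq> {}"

definition plus_connected :: "square set \<Rightarrow> bool" where
  "plus_connected A \<longleftrightarrow> (\<forall>q\<in>A. \<forall>r\<in>A. \<exists>qs. qs \<noteq> [] \<and> hd qs = q \<and> last qs = r \<and>
     distinct qs \<and> set qs \<subseteq> A \<and> successively plus_adjacent qs)"

text \<open>
  The edge set of the graph formed by the corners and edges of the squares in \<open>A\<close>. Every corner
  of a square is an endpoint of one of its edges, so the edges determine this graph.
\<close>

definition graph_edges :: "square set \<Rightarrow> edge set" where
  "graph_edges A = (\<Union>q\<in>A. square_edges q)"

abbreviation lattice_edges :: "edge set" where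
  "lattice_edges \<equiv> graph_edges UNIV"

text \<open>
  A cycle is identified with its set of edges. Since the vertices \<open>vs\<close> are distinct, requiring at
  least three of them says that the traversed edges are distinct: it excludes precisely the
  empty walk and traversing one edge back and forth.
\<close>

definition is_cycle :: "edge set \<Rightarrow> edge set \<Rightarrow> bool" where
  "is_cycle E C \<longleftrightarrow> C \<subseteq> E \<and> (\<exists>vs. distinct vs \<and> 3 \<le> length vs \<and>
     C = {{vs ! i, vs ! (Suc i mod length vs)} | i. i < length vs})"

definition cycle_trace :: "edge set \<Rightarrow> point set" where
  "cycle_trace C = (\<Union>e\<in>C. convex hull e)"

definition interior_squares :: "edge set \<Rightarrow> square set" where
  "interior_squares C = {q. open_square q \<subseteq> inside (cycle_trace C)}"

definition exterior_squares :: "edge set \<Rightarrow> square set" where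
  "exterior_squares C = {q. open_square q \<subseteq> outside (cycle_trace C)}"

definition exterior_edge :: "edge \<Rightarrow> edge set \<Rightarrow> bool" where
  "exterior_edge e C \<longleftrightarrow> (\<forall>q. e \<in> square_edges q \<longrightarrow> q \<in> exterior_squares C)"

definition outermost_boundary :: "square set \<Rightarrow> edge set" where
  "outermost_boundary A = {e \<in> graph_edges A.
     \<forall>C'. is_cycle (graph_edges A) C' \<longrightarrow> e \<in> C' \<or> exterior_edge e C'}"

end

theory Submission imports Defs begin

text \<open>
  The trace \<open>J\<close> of a lattice cycle is a simple closed curve, because two distinct edges of the
  tiling meet only in common endpoints (\<open>lattice_edges_meet_in_endpoints\<close>). By the Jordan curve
  theorem, \<open>inside J\<close> is connected and bounded, and \<open>J\<close> is the frontier of both \<open>inside J\<close> and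
  \<open>outside J\<close>. Everything else follows from these facts and one local picture: the open edge of
  \<open>e\<close>, together with the two open squares at \<open>e\<close>, forms an open box, here called the domain of
  \<open>e\<close>. A cycle that does not use \<open>e\<close> misses this box, so the box lies on one side of the cycle;
  crossing \<open>e\<close> does not change sides.

  Finiteness is boundedness of \<open>inside J\<close>. For plus connectedness
  (\<open>plus_connected_interior_squares\<close>), delete the countably many lattice vertices from
  \<open>inside J\<close>; it remains connected, and it is now covered by open squares and by domains of edges
  not on the cycle. Moving through such a domain is a plus adjacent step between interior squares,
  so every interior square can be reached from any other.

  For the boundary (\<open>outermost_boundary_interior_squares\<close>), each edge of \<open>C\<close> lies in both
  frontiers, hence borders an interior and an exterior square. The interior squares show that \<open>C\<close>
  is itself a cycle in their graph, and testing against \<open>C\<close> excludes every edge not on \<open>C\<close>, as an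
  edge of an interior square does not lie in the exterior of \<open>C\<close>. Conversely, a cycle \<open>C'\<close> in
  that graph stays in \<open>J \<union> inside J\<close>, so the outside of \<open>C\<close> is contained in the outside of \<open>C'\<close>.
  If \<open>C'\<close> avoids an edge \<open>e\<close> of \<open>C\<close>, the domain of \<open>e\<close> lies on one side of \<open>C'\<close>, and the
  exterior square of \<open>C\<close> at \<open>e\<close> shows that this side is the outside.
\<close>

section \<open>Edges and squares of the tiling\<close>

text \<open>
  The bottom and the left edge of the square \<open>(i, j)\<close>. Every edge of the tiling is exactly one of
  these, for exactly one square.
\<close>

definition hedge :: "int \<Rightarrow> int \<Rightarrow> edge" where
  "hedge i j = {(of_int i - 1/2, of_int j - 1/2), (of_int i + 1/2, of_int j - 1/2)}"

definition vedge :: "int \<Rightarrow> int \<Rightarrow> edge" where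
  "vedge i j = {(of_int i - 1/2, of_int j - 1/2), (of_int i - 1/2, of_int j + 1/2)}"

lemma square_edges_eq: "square_edges (i, j) = {hedge i j, vedge (i + 1) j, hedge i (j + 1), vedge i j}"
  by (auto simp: square_edges_def hedge_def vedge_def Let_def insert_commute algebra_simps)

lemma lattice_edge_cases:
  assumes "e \<in> lattice_edges"
  obtains i j where "e = hedge i j" | i j where "e = vedge i j"
  using assms by (auto simp: graph_edges_def square_edges_eq)

lemma hedge_inject: "hedge i j = hedge k l \<longleftrightarrow> i = k \<and> j = l"
  and vedge_inject: "vedge i j = vedge k l \<longleftrightarrow> i = k \<and> j = l"
  and hedge_neq_vedge: "hedge i j \<noteq> vedge k l"
  by (auto simp: hedge_def vedge_def doubleton_eq_iff)

lemma squares_at_hedge: "hedge i j \<in> square_edges q \<longleftrightarrow> q = (i, j) \<or> q = (i, j - 1)"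
  and squares_at_vedge: "vedge i j \<in> square_edges q \<longleftrightarrow> q = (i, j) \<or> q = (i - 1, j)"
  by (cases q; auto simp: square_edges_eq hedge_inject vedge_inject hedge_neq_vedge
        hedge_neq_vedge[symmetric])+

lemma mem_hedge_segment:
  "(x, y) \<in> convex hull hedge i j \<longleftrightarrow> of_int i - 1/2 \<le> x \<and> x \<le> of_int i + 1/2 \<and> y = of_int j - 1/2"
  unfolding hedge_def segment_convex_hull[symmetric]
  by (subst closed_segment_same_snd) (auto simp: closed_segment_eq_real_ivl)

lemma mem_vedge_segment:
  "(x, y) \<in> convex hull vedge i j \<longleftrightarrow> of_int j - 1/2 \<le> y \<and> y \<le> of_int j + 1/2 \<and> x = of_int i - 1/2"
  unfolding vedge_def segment_convex_hull[symmetric]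
  by (subst closed_segment_same_fst) (auto simp: closed_segment_eq_real_ivl)

lemma mem_box_prod: "(x, y) \<in> box (a, b) (c, d) \<longleftrightarrow> a < x \<and> x < c \<and> b < y \<and> y < (d::real)"
  for x :: real
  by (auto simp: box_prod)

lemma mem_open_square:
  "(x, y) \<in> open_square (i, j) \<longleftrightarrow> of_int i - 1/2 < x \<and> x < of_int i + 1/2 \<and>
     of_int j - 1/2 < y \<and> y < of_int j + 1/2"
  by (simp add: open_square_def mem_box_prod)

lemma open_open_square: "open (open_square q)"
  and connected_open_square: "connected (open_square q)"
  by (auto simp: open_square_def convex_connected split: prod.split)

lemma centre_in_open_square: "(of_int i, of_int j) \<in> open_square (i, j)"
  by (simp add: mem_open_square)

lemma open_square_nonempty: "open_square q \<noteq> {}"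
  using centre_in_open_square by (cases q) blast

lemma open_squares_disjoint:
  assumes "p \<in> open_square q" "p \<in> open_square r"
  shows "q = r"
proof (cases p, cases q, cases r)
  fix x y i j k l assume "p = (x, y)" "q = (i, j)" "r = (k, l)"
  with assms show ?thesis by (auto simp: mem_open_square)
qed

lemma open_square_misses_edge:
  assumes "e \<in> lattice_edges"
  shows "open_square q \<inter> convex hull e = {}"
proof -
  have False if "p \<in> open_square q" "p \<in> convex hull e" for p
  proof (cases p, cases q)
    fix x y k l assume "p = (x, y)" "q = (k, l)"
    with that show False
      by (cases rule: lattice_edge_cases[OF assms])
        (auto simp: mem_open_square mem_hedge_segment mem_vedge_segment; linarith)+
  qed
  then show ?thesis by blast
qed

lemma lattice_edges_meet_in_endpoints:
  assumes "e \<in> lattice_edges" "f \<in> lattice_edges" "e \<noteq> f"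
  shows "convex hull e \<inter> convex hull f \<subseteq> e \<inter> f"
proof -
  have hh: "p \<in> hedge i j \<inter> hedge k l"
    if "p \<in> convex hull hedge i j" "p \<in> convex hull hedge k l" "hedge i j \<noteq> hedge k l" for p i j k l
  proof -
    obtain x y where p: "p = (x, y)" by (cases p)
    have "j = l" "i = k + 1 \<or> k = i + 1"
      using that unfolding p mem_hedge_segment hedge_inject by linarith+
    with that(1,2) show ?thesis
      unfolding p mem_hedge_segment by (auto simp: hedge_def)
  qed
  have vv: "p \<in> vedge i j \<inter> vedge k l"
    if "p \<in> convex hull vedge i j" "p \<in> convex hull vedge k l" "vedge i j \<noteq> vedge k l" for p i j k l
  proof -
    obtain x y where p: "p = (x, y)" by (cases p)
    have "i = k" "j = l + 1 \<or> l = j + 1"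
      using that unfolding p mem_vedge_segment vedge_inject by linarith+
    with that(1,2) show ?thesis
      unfolding p mem_vedge_segment by (auto simp: vedge_def)
  qed
  have hv: "p \<in> hedge i j \<inter> vedge k l"
    if "p \<in> convex hull hedge i j" "p \<in> convex hull vedge k l" for p i j k l
  proof -
    obtain x y where p: "p = (x, y)" by (cases p)
    have "k = i \<or> k = i + 1" "j = l \<or> j = l + 1"
      using that unfolding p mem_hedge_segment mem_vedge_segment by linarith+
    with that show ?thesis
      unfolding p mem_hedge_segment mem_vedge_segment by (auto simp: hedge_def vedge_def)
  qed
  show ?thesis
    using assms(3) hh vv hv
    by (cases rule: lattice_edge_cases[OF assms(1)]; cases rule: lattice_edge_cases[OF assms(2)]) blast+
qed

text \<open>
  The open neighbourhood of the open edge \<open>e\<close> that reaches to the far sides of the two squares at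
  \<open>e\<close>. Defined through the squares, its disjointness from all other edges is immediate; that it is
  open and connected is read off from its description as a box (a horizontal and a vertical case).
\<close>

definition edge_domain :: "edge \<Rightarrow> point set" where
  "edge_domain e = (convex hull e - e) \<union> (\<Union>q\<in>{q. e \<in> square_edges q}. open_square q)"

lemma edge_domain_hedge:
  "edge_domain (hedge i j) = box (of_int i - 1/2, of_int j - 3/2) (of_int i + 1/2, of_int j + 1/2)"
proof -
  have squares: "(\<Union>q\<in>{q. hedge i j \<in> square_edges q}. open_square q) = open_square (i, j) \<union> open_square (i, j - 1)"
    by (auto simp: squares_at_hedge)
  have "(x, y) \<in> hedge i j \<longleftrightarrow> (x = of_int i - 1/2 \<or> x = of_int i + 1/2) \<and> y = of_int j - 1/2" for x y
    by (auto simp: hedge_def)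
  then have "(x, y) \<in> edge_domain (hedge i j) \<longleftrightarrow>
      (x, y) \<in> box (of_int i - 1/2, of_int j - 3/2) (of_int i + 1/2, of_int j + 1/2)" for x y
    unfolding edge_domain_def squares by (auto simp: mem_hedge_segment mem_open_square mem_box_prod)
  then show ?thesis by auto
qed

lemma edge_domain_vedge:
  "edge_domain (vedge i j) = box (of_int i - 3/2, of_int j - 1/2) (of_int i + 1/2, of_int j + 1/2)"
proof -
  have squares: "(\<Union>q\<in>{q. vedge i j \<in> square_edges q}. open_square q) = open_square (i, j) \<union> open_square (i - 1, j)"
    by (auto simp: squares_at_vedge)
  have "(x, y) \<in> vedge i j \<longleftrightarrow> (y = of_int j - 1/2 \<or> y = of_int j + 1/2) \<and> x = of_int i - 1/2" for x y
    by (auto simp: vedge_def)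
  then have "(x, y) \<in> edge_domain (vedge i j) \<longleftrightarrow>
      (x, y) \<in> box (of_int i - 3/2, of_int j - 1/2) (of_int i + 1/2, of_int j + 1/2)" for x y
    unfolding edge_domain_def squares by (auto simp: mem_vedge_segment mem_open_square mem_box_prod)
  then show ?thesis by auto
qed

lemma open_edge_domain: "e \<in> lattice_edges \<Longrightarrow> open (edge_domain e)"
  and connected_edge_domain: "e \<in> lattice_edges \<Longrightarrow> connected (edge_domain e)"
  by (auto elim!: lattice_edge_cases simp: edge_domain_hedge edge_domain_vedge open_box convex_connected)

lemma edge_in_closure_square:
  assumes "e \<in> square_edges q"
  shows "convex hull e \<subseteq> closure (open_square q)"
proof (rule hull_minimal)
  obtain i j where q: "q = (i, j)" by (cases q)
  have closure_q: "closure (open_square q) = cbox (of_int i - 1/2, of_int j - 1/2) (of_int i + 1/2, of_int j + 1/2)"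
    using open_square_nonempty[of q] by (simp add: q open_square_def closure_box)
  then show "e \<subseteq> closure (open_square q)"
    unfolding closure_q using assms unfolding q square_edges_eq hedge_def vedge_def by auto
  show "convex (closure (open_square q))"
    unfolding closure_q by (rule convex_box)
qed

lemma edge_domain_misses_other_edge:
  assumes "e \<in> lattice_edges" "f \<in> lattice_edges" "e \<noteq> f"
  shows "edge_domain e \<inter> convex hull f = {}"
  using lattice_edges_meet_in_endpoints[OF assms] open_square_misses_edge[OF assms(2)]
  by (fastforce simp: edge_domain_def)

lemma edge_domain_off_edge:
  assumes "p \<in> edge_domain e" "p \<notin> convex hull e"
  obtains q where "e \<in> square_edges q" "p \<in> open_square q"
  using assms by (auto simp: edge_domain_def)

text \<open>
  Rounding the coordinates gives the square whose half-open box contains the point; the point is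
  then in that open square or on its left or bottom edge.
\<close>

lemma edge_domains_cover:
  assumes "p \<notin> \<Union>lattice_edges"
  obtains e where "e \<in> lattice_edges" "p \<in> edge_domain e"
proof -
  obtain x y where p: "p = (x, y)" by (cases p)
  define i j where "i = \<lfloor>x + 1/2\<rfloor>" and "j = \<lfloor>y + 1/2\<rfloor>"
  have ij: "of_int i - 1/2 \<le> x" "x < of_int i + 1/2" "of_int j - 1/2 \<le> y" "y < of_int j + 1/2"
    unfolding i_def j_def by linarith+
  have e: "hedge i j \<in> lattice_edges" "vedge i j \<in> lattice_edges"
    unfolding graph_edges_def squares_at_hedge squares_at_vedge UN_iff by blast+
  have "x \<noteq> of_int i - 1/2 \<or> y \<noteq> of_int j - 1/2"
    using assms e(1) by (auto simp: p hedge_def)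
  with ij have "p \<in> edge_domain (hedge i j) \<or> p \<in> edge_domain (vedge i j)"
    by (auto simp: p edge_domain_hedge edge_domain_vedge mem_box_prod)
  with e that show ?thesis by blast
qed

lemma countable_vertices: "countable (\<Union>lattice_edges)"
proof -
  have "countable lattice_edges"
    unfolding graph_edges_def
    by (rule countable_UN) (auto simp: square_edges_eq split: prod.split)
  then show ?thesis
    by (rule countable_UN[of lattice_edges "\<lambda>e. e", simplified])
      (erule lattice_edge_cases; simp add: hedge_def vedge_def)
qed

text \<open>
  The open squares are dense: an open set contains a point that is not one of the countably many
  vertices, hence meets some edge domain in an open set, and a segment has empty interior in the
  plane.
\<close>

lemma open_meets_open_square:
  assumes "open T" "T \<noteq> {}"
  obtains q p where "p \<in> T" "p \<in> open_square q"
proof -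
  have "\<not> T \<subseteq> \<Union>lattice_edges"
  proof
    obtain a r where "r > 0" "ball a r \<subseteq> T" using assms open_contains_ball by blast
    assume "T \<subseteq> \<Union>lattice_edges"
    with \<open>ball a r \<subseteq> T\<close> have "countable (ball a r)"
      by (intro countable_subset[OF _ countable_vertices]) (rule subset_trans)
    with uncountable_ball[OF \<open>r > 0\<close>, of a] show False by simp
  qed
  then obtain p where "p \<in> T" "p \<notin> \<Union>lattice_edges" by blast
  then obtain e where e: "e \<in> lattice_edges" "p \<in> edge_domain e" by (metis edge_domains_cover)
  have "\<not> T \<inter> edge_domain e \<subseteq> convex hull e"
  proof
    assume "T \<inter> edge_domain e \<subseteq> convex hull e"
    then have "p \<in> interior (convex hull e)"
      using \<open>p \<in> T\<close> e \<open>open T\<close> open_edge_domain by (intro interiorI[of "T \<inter> edge_domain e"]) auto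
    moreover obtain a b where "e = {a, b}"
      by (cases rule: lattice_edge_cases[OF e(1)]) (auto simp: hedge_def vedge_def)
    ultimately show False
      by (simp add: interior_closed_segment_ge2 flip: segment_convex_hull)
  qed
  then obtain z where z: "z \<in> T" "z \<in> edge_domain e" "z \<notin> convex hull e" by blast
  show ?thesis
    by (rule edge_domain_off_edge[OF z(2,3)]) (rule that[OF z(1)])
qed

section \<open>The Jordan curve theorem for lattice cycles\<close>

text \<open>
  The Jordan curve theorem for complex-valued curves, carried over by the linear isomorphism
  between \<open>complex\<close> and \<open>real \<times> real\<close>.
\<close>

lemma Jordan_inside_outside_plane:
  fixes c :: "real \<Rightarrow> point"
  assumes "simple_path c" "pathfinish c = pathstart c"
  shows "connected (inside (path_image c))"
    and "frontier (inside (path_image c)) = path_image c"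
    and "frontier (outside (path_image c)) = path_image c"
proof -
  define f :: "complex \<Rightarrow> point" where "f z = (Re z, Im z)" for z
  define g :: "point \<Rightarrow> complex" where "g p = Complex (fst p) (snd p)" for p
  have lin: "linear f" "linear g"
    by (auto simp: f_def g_def complex_eq_iff intro!: linearI)
  have fg: "f (g p) = p" and gf: "g (f z) = z" for p z
    by (auto simp: f_def g_def)
  have bij: "bij f" "inj g"
    by (metis bijI' fg gf) (metis fg injI)
  have img: "path_image c = f ` path_image (g \<circ> c)"
    by (simp add: path_image_compose image_image fg)
  have sp: "simple_path (g \<circ> c)" "pathfinish (g \<circ> c) = pathstart (g \<circ> c)"
    using assms lin bij by (auto simp: simple_path_linear_image_eq pathfinish_compose pathstart_compose)
  have fr: "frontier (f ` S) = f ` frontier S" for S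
    using lin bij
    by (simp add: frontier_def closure_injective_linear_image interior_bijective_linear_image
        bij_is_inj image_set_diff)
  obtain inner outer where io:
    "open inner" "connected inner" "connected outer" "bounded inner" "\<not> bounded outer"
    "inner \<inter> outer = {}" "inner \<union> outer = - path_image (g \<circ> c)"
    "frontier inner = path_image (g \<circ> c)" "frontier outer = path_image (g \<circ> c)"
    using Jordan_curve[OF sp] by metis
  have "bounded (f ` inner)" "open (f ` inner)"
    using io lin bij by (auto simp: bounded_linear_image linear_linear open_bijective_linear_image_eq)
  moreover have "\<not> bounded (f ` outer)"
    using io(5) lin(2) bounded_linear_image[of "f ` outer" g] by (auto simp: image_image gf linear_linear)
  moreover have un: "f ` inner \<union> f ` outer = - path_image c"
    unfolding img using io(7) bij by (metis bij_image_Compl_eq image_Un)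
  ultimately have ins: "inside (path_image c) = f ` inner"
    using inside_subset[of "f ` outer" "f ` inner" "path_image c"] io lin
      interior_inside_frontier[of "f ` inner"]
    by (simp add: connected_linear_image fr interior_open img subset_antisym)
  have "f ` inner \<inter> f ` outer = {}"
    using io(6) bij by (metis bij_is_inj image_Int image_empty)
  then have out: "outside (path_image c) = f ` outer"
    using ins un by (auto simp: outside_inside)
  show "connected (inside (path_image c))"
    by (simp add: ins connected_linear_image io lin)
  show "frontier (inside (path_image c)) = path_image c"
    "frontier (outside (path_image c)) = path_image c"
    unfolding ins out fr using io img by auto
qed

text \<open>
  Appending a lattice edge to an arc keeps it an arc: the new edge meets each earlier one only in
  common endpoints, and, the vertices being distinct, the only such endpoint is the joint.
\<close>

lemma lattice_path_is_arc:
  assumes "inj_on v {..Suc n}" "\<And>i. i \<le> n \<Longrightarrow> {v i, v (Suc i)} \<in> lattice_edges"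
  shows "\<exists>g. arc g \<and> pathstart g = v 0 \<and> pathfinish g = v (Suc n) \<and>
           path_image g = (\<Union>i\<le>n. convex hull {v i, v (Suc i)})"
  using assms
proof (induction n)
  case 0
  then have "v 0 \<noteq> v (Suc 0)" by (auto dest: inj_onD)
  then have "arc (linepath (v 0) (v (Suc 0)))" by (rule arc_linepath)
  then show ?case by (intro exI[of _ "linepath (v 0) (v (Suc 0))"]) (simp add: segment_convex_hull)
next
  case (Suc n)
  have "inj_on v {..Suc n}" using Suc.prems(1) by (rule inj_on_subset) auto
  then obtain g where g: "arc g" "pathstart g = v 0" "pathfinish g = v (Suc n)"
    "path_image g = (\<Union>i\<le>n. convex hull {v i, v (Suc i)})"
    using Suc.IH Suc.prems(2) by auto
  let ?h = "linepath (v (Suc n)) (v (Suc (Suc n)))"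
  have v: "v i = v k \<longleftrightarrow> i = k" if "i \<le> Suc (Suc n)" "k \<le> Suc (Suc n)" for i k
    using Suc.prems(1) that by (auto dest: inj_onD)
  have "convex hull {v i, v (Suc i)} \<inter> convex hull {v (Suc n), v (Suc (Suc n))} \<subseteq> {v (Suc n)}"
    if "i \<le> n" for i
  proof -
    have "{v i, v (Suc i)} \<noteq> {v (Suc n), v (Suc (Suc n))}"
      using that by (simp add: doubleton_eq_iff v)
    then have "convex hull {v i, v (Suc i)} \<inter> convex hull {v (Suc n), v (Suc (Suc n))}
        \<subseteq> {v i, v (Suc i)} \<inter> {v (Suc n), v (Suc (Suc n))}"
      using that by (intro lattice_edges_meet_in_endpoints Suc.prems(2)) auto
    also have "\<dots> \<subseteq> {v (Suc n)}"
      using that by (auto simp: v)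
    finally show ?thesis .
  qed
  then have "arc (g +++ ?h)"
    using g by (intro arc_join arc_linepath) (auto simp: v segment_convex_hull)
  then show ?case using g
    by (intro exI[of _ "g +++ ?h"]) (simp add: path_image_join atMost_Suc segment_convex_hull Un_commute)
qed

lemma cycle_trace_is_Jordan_curve:
  assumes "is_cycle lattice_edges C"
  obtains c where "simple_path c" "pathfinish c = pathstart c" "path_image c = cycle_trace C"
proof -
  obtain vs where C: "C \<subseteq> lattice_edges" and vs: "distinct vs" "3 \<le> length vs"
    "C = {{vs ! i, vs ! (Suc i mod length vs)} | i. i < length vs}"
    using assms by (auto simp: is_cycle_def)
  obtain n where n: "length vs = Suc (Suc (Suc n))"
    by (rule that[of "length vs - 3"]) (use vs(2) in linarith)
  define v where "v = (!) vs"
  have v: "v i = v k \<longleftrightarrow> i = k" if "i \<le> Suc (Suc n)" "k \<le> Suc (Suc n)" for i k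
    using vs(1) that n by (simp add: v_def nth_eq_iff_index_eq)
  have Ceq: "C = insert {v (Suc (Suc n)), v 0} ((\<lambda>i. {v i, v (Suc i)}) ` {..Suc n})"
  proof -
    have "C = (\<lambda>i. {vs ! i, vs ! (Suc i mod length vs)}) ` {..Suc (Suc n)}"
      using vs(3) n by (auto simp: less_Suc_eq_le)
    also have "\<dots> = insert {v (Suc (Suc n)), v 0} ((\<lambda>i. {v i, v (Suc i)}) ` {..Suc n})"
      unfolding atMost_Suc[of "Suc n"] image_insert by (intro arg_cong2[where f=insert] image_cong) (auto simp: n v_def)
    finally show ?thesis .
  qed
  have edges: "{v i, v (Suc i)} \<in> lattice_edges" if "i \<le> Suc n" for i
    using C Ceq that by auto
  obtain g where g: "arc g" "pathstart g = v 0" "pathfinish g = v (Suc (Suc n))"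
    "path_image g = (\<Union>i\<le>Suc n. convex hull {v i, v (Suc i)})"
    using lattice_path_is_arc[of v "Suc n"] edges v by (auto simp: inj_on_def)
  let ?h = "linepath (v (Suc (Suc n))) (v 0)"
  have "convex hull {v i, v (Suc i)} \<inter> convex hull {v (Suc (Suc n)), v 0} \<subseteq> {v 0, v (Suc (Suc n))}"
    if "i \<le> Suc n" for i
  proof -
    \<comment> \<open>Here the cycle must have three vertices: with two, the closing edge would be the first.\<close>
    have "{v i, v (Suc i)} \<noteq> {v (Suc (Suc n)), v 0}"
      using that by (auto simp: doubleton_eq_iff v)
    moreover have "{v (Suc (Suc n)), v 0} \<in> lattice_edges" using C Ceq by auto
    ultimately show ?thesis
      using lattice_edges_meet_in_endpoints[OF edges[OF that]] by blast
  qed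
  then have "simple_path (g +++ ?h)"
    using g by (intro simple_path_join_loop arc_linepath) (auto simp: v segment_convex_hull)
  moreover have "path_image (g +++ ?h) = cycle_trace C"
    using g by (simp add: path_image_join cycle_trace_def Ceq segment_convex_hull Un_commute)
  ultimately show ?thesis
    using g by (intro that[of "g +++ ?h"]) auto
qed

lemma
  assumes "is_cycle lattice_edges C"
  shows connected_inside_cycle: "connected (inside (cycle_trace C))"
    and frontier_inside_cycle: "frontier (inside (cycle_trace C)) = cycle_trace C"
    and frontier_outside_cycle: "frontier (outside (cycle_trace C)) = cycle_trace C"
    and compact_cycle_trace: "compact (cycle_trace C)"
proof -
  obtain c where c: "simple_path c" "pathfinish c = pathstart c" and img: "path_image c = cycle_trace C"
    by (rule cycle_trace_is_Jordan_curve[OF assms])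
  show "connected (inside (cycle_trace C))" "frontier (inside (cycle_trace C)) = cycle_trace C"
    "frontier (outside (cycle_trace C)) = cycle_trace C" "compact (cycle_trace C)"
    using Jordan_inside_outside_plane[OF c] compact_simple_path_image[OF c(1)] unfolding img by blast+
qed

lemma connected_subset_inside:
  assumes "connected T" "T \<inter> S = {}" "T \<inter> inside S \<noteq> {}"
  shows "T \<subseteq> inside S"
  using assms inside_same_component[of S] by (fastforce simp: connected_component_def)

lemma connected_subset_outside:
  assumes "connected T" "T \<inter> S = {}" "T \<inter> outside S \<noteq> {}"
  shows "T \<subseteq> outside S"
  using assms outside_same_component[of S] by (fastforce simp: connected_component_def)

section \<open>Squares inside and outside a cycle\<close>

lemma open_square_misses_cycle:
  assumes "C \<subseteq> lattice_edges"
  shows "open_square q \<inter> cycle_trace C = {}"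
  using open_square_misses_edge[of _ q] assms unfolding cycle_trace_def by blast

lemma edge_domain_misses_cycle:
  assumes "C \<subseteq> lattice_edges" "e \<in> lattice_edges" "e \<notin> C"
  shows "edge_domain e \<inter> cycle_trace C = {}"
  using edge_domain_misses_other_edge[OF assms(2)] assms unfolding cycle_trace_def by blast

lemma interior_squareI:
  assumes "C \<subseteq> lattice_edges" "p \<in> open_square q" "p \<in> inside (cycle_trace C)"
  shows "q \<in> interior_squares C"
  using connected_subset_inside[OF connected_open_square open_square_misses_cycle[OF assms(1)], of q] assms(2,3)
  unfolding interior_squares_def by blast

lemma exterior_squareI:
  assumes "C \<subseteq> lattice_edges" "p \<in> open_square q" "p \<in> outside (cycle_trace C)"
  shows "q \<in> exterior_squares C"
  using connected_subset_outside[OF connected_open_square open_square_misses_cycle[OF assms(1)], of q] assms(2,3)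
  unfolding exterior_squares_def by blast

lemma interior_exterior_disjoint: "interior_squares C \<inter> exterior_squares C = {}"
  using open_square_nonempty inside_Int_outside
  by (fastforce simp: interior_squares_def exterior_squares_def)

lemma edge_domain_meets_edge:
  assumes "e \<in> lattice_edges"
  shows "edge_domain e \<inter> convex hull e \<noteq> {}"
proof (cases rule: lattice_edge_cases[OF assms])
  case (1 i j)
  then have "(of_int i, of_int j - 1/2) \<in> edge_domain e \<inter> convex hull e"
    by (simp add: edge_domain_hedge mem_hedge_segment mem_box_prod)
  then show ?thesis by blast
next
  case (2 i j)
  then have "(of_int i - 1/2, of_int j) \<in> edge_domain e \<inter> convex hull e"
    by (simp add: edge_domain_vedge mem_vedge_segment mem_box_prod)
  then show ?thesis by blast
qed

text \<open>
  For a region \<open>U\<close> whose frontier is the cycle, points of \<open>U\<close> come arbitrarily close to the middle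
  of the edge, so some lie in its domain; since \<open>U\<close> avoids the edge, they lie in a square at it.
\<close>

lemma cycle_edge_borders_square_in:
  assumes "C \<subseteq> lattice_edges" "e \<in> C" "frontier U = cycle_trace C" "U \<inter> cycle_trace C = {}"
  obtains q p where "e \<in> square_edges q" "p \<in> open_square q" "p \<in> U"
proof -
  have e: "e \<in> lattice_edges" using assms by blast
  then obtain z where z: "z \<in> edge_domain e" "z \<in> convex hull e"
    using edge_domain_meets_edge by blast
  with assms have "z \<in> closure U" by (auto simp: cycle_trace_def frontier_def)
  then obtain p where "p \<in> edge_domain e" "p \<in> U"
    using z(1) open_edge_domain[OF e] closure_iff_nhds_not_empty
    by (metis (no_types, opaque_lifting) disjoint_iff inf_commute subset_refl)
  moreover have "p \<notin> convex hull e" using \<open>p \<in> U\<close> assms by (auto simp: cycle_trace_def)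
  ultimately show ?thesis using edge_domain_off_edge that by metis
qed

lemma is_cycle_subset: "is_cycle E C \<Longrightarrow> C \<subseteq> E"
  by (simp add: is_cycle_def)

lemma cycle_edge_has_interior_square:
  assumes "is_cycle lattice_edges C" "e \<in> C"
  obtains q where "e \<in> square_edges q" "q \<in> interior_squares C"
proof -
  note C = is_cycle_subset[OF assms(1)]
  show ?thesis
    by (rule cycle_edge_borders_square_in[OF C assms(2) frontier_inside_cycle[OF assms(1)] inside_no_overlap])
      (blast intro: that interior_squareI[OF C])
qed

lemma cycle_edge_has_exterior_square:
  assumes "is_cycle lattice_edges C" "e \<in> C"
  obtains q where "e \<in> square_edges q" "q \<in> exterior_squares C"
proof -
  note C = is_cycle_subset[OF assms(1)]
  show ?thesis
    by (rule cycle_edge_borders_square_in[OF C assms(2) frontier_outside_cycle[OF assms(1)] outside_no_overlap])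
      (blast intro: that exterior_squareI[OF C])
qed

section \<open>The interior squares are plus connected\<close>

lemma finite_interior_squares:
  assumes "is_cycle lattice_edges C"
  shows "finite (interior_squares C)"
proof -
  have "bounded (inside (cycle_trace C))"
    using compact_cycle_trace[OF assms] by (simp add: bounded_inside compact_imp_bounded)
  then obtain B where B: "\<And>p. p \<in> inside (cycle_trace C) \<Longrightarrow> norm p \<le> B"
    by (auto simp: bounded_iff)
  have "interior_squares C \<subseteq> {- \<lceil>B\<rceil>..\<lceil>B\<rceil>} \<times> {- \<lceil>B\<rceil>..\<lceil>B\<rceil>}"
  proof (clarify)
    fix i j assume "(i, j) \<in> interior_squares C"
    then have "norm (of_int i :: real, of_int j :: real) \<le> B"
      using centre_in_open_square[of i j] by (intro B) (auto simp: interior_squares_def)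
    then have "\<bar>of_int i\<bar> \<le> B" "\<bar>of_int j\<bar> \<le> B"
      using norm_fst_le[of "of_int i :: real" "of_int j :: real"]
        norm_snd_le[of "of_int j :: real" "of_int i :: real"] by auto
    then have "\<bar>i\<bar> \<le> \<lceil>B\<rceil>" "\<bar>j\<bar> \<le> \<lceil>B\<rceil>"
      by linarith+
    then show "i \<in> {- \<lceil>B\<rceil>..\<lceil>B\<rceil>} \<and> j \<in> {- \<lceil>B\<rceil>..\<lceil>B\<rceil>}"
      by auto
  qed
  then show ?thesis by (rule finite_subset) auto
qed

text \<open>
  When the next vertex has been visited before, the walk is cut back to that earlier visit.
\<close>

lemma distinct_walk_of_rtranclp:
  assumes "(\<lambda>x y. y \<in> A \<and> P x y)\<^sup>*\<^sup>* a b" "a \<in> A"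
  shows "\<exists>xs. xs \<noteq> [] \<and> hd xs = a \<and> last xs = b \<and> distinct xs \<and> set xs \<subseteq> A \<and> successively P xs"
  using assms(1)
proof (induction rule: rtranclp_induct)
  case base
  then show ?case using assms(2) by (intro exI[of _ "[a]"]) auto
next
  case (step y z)
  then obtain xs where xs: "xs \<noteq> []" "hd xs = a" "last xs = y" "distinct xs" "set xs \<subseteq> A" "successively P xs"
    by blast
  show ?case
  proof (cases "z \<in> set xs")
    case True
    then obtain us ws where "xs = us @ z # ws" by (meson split_list)
    with xs show ?thesis
      by (intro exI[of _ "us @ [z]"]) (auto simp: successively_append_iff hd_append)
  next
    case False
    with xs step.hyps show ?thesis
      by (intro exI[of _ "xs @ [z]"]) (auto simp: successively_append_iff)
  qed
qed

text \<open>
  Vertices are removed first because around a vertex the squares meet without being plus adjacent.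
  On the remaining connected set the property of lying in a reachable square is propagated by
  \<open>connected_induction\<close>; it is tested only on the dense set of points in open squares, since points
  on edges belong to no open square.
\<close>

lemma plus_connected_interior_squares:
  assumes cyc: "is_cycle lattice_edges C"
  shows "plus_connected (interior_squares C)"
  unfolding plus_connected_def
proof (intro ballI)
  define A where "A = interior_squares C"
  define V where "V = \<Union>lattice_edges"
  define S where "S = inside (cycle_trace C) - V"
  note C = is_cycle_subset[OF cyc]
  have open_inside: "open (inside (cycle_trace C))"
    using compact_cycle_trace[OF cyc] by (simp add: compact_imp_closed open_inside)
  then have conn: "connected S"
    unfolding S_def V_def using connected_inside_cycle[OF cyc] countable_vertices
    by (intro connected_open_diff_countable) auto
  have off: "p \<notin> V" if "p \<in> open_square q" for p q
  proof
    assume "p \<in> V"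
    then obtain e where "e \<in> lattice_edges" "p \<in> convex hull e" unfolding V_def by (meson UnionE hull_inc)
    then show False using open_square_misses_edge that by blast
  qed
  fix q r assume q: "q \<in> interior_squares C" and r: "r \<in> interior_squares C"
  obtain a b where a: "a \<in> open_square q" and b: "b \<in> open_square r"
    using open_square_nonempty by blast
  let ?step = "\<lambda>s t. t \<in> A \<and> plus_adjacent s t"
  let ?Q = "\<lambda>p. \<exists>s. ?step\<^sup>*\<^sup>* q s \<and> s \<in> A \<and> p \<in> open_square s"
  have "?Q b"
  proof (rule connected_induction[OF conn, where P = "\<lambda>p. \<exists>s. p \<in> open_square s" and Q = ?Q and a = a])
    show "\<exists>z. z \<in> T \<and> (\<exists>s. z \<in> open_square s)" if T: "openin (top_of_set S) T" "p \<in> T" for T p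
    proof -
      obtain U where U: "open U" "T = S \<inter> U" using T(1) by (auto simp: openin_open)
      have "open (inside (cycle_trace C) \<inter> U)" "inside (cycle_trace C) \<inter> U \<noteq> {}"
        using U T(2) open_inside by (auto simp: S_def)
      then obtain s z where "z \<in> inside (cycle_trace C) \<inter> U" "z \<in> open_square s"
        by (rule open_meets_open_square)
      with off U show ?thesis unfolding S_def by blast
    qed
    show "a \<in> S" "b \<in> S" using a b q r off by (auto simp: S_def interior_squares_def)
    show "\<exists>s. a \<in> open_square s" "\<exists>s. b \<in> open_square s" using a b by blast+
    show "?Q a" using a q unfolding A_def by blast
    show "\<exists>T. openin (top_of_set S) T \<and> p \<in> T \<and>
        (\<forall>x\<in>T. \<forall>y\<in>T. (\<exists>s. x \<in> open_square s) \<and> (\<exists>s. y \<in> open_square s) \<and> ?Q x \<longrightarrow> ?Q y)"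
      if p: "p \<in> S" for p
    proof -
      obtain e where e: "e \<in> lattice_edges" "p \<in> edge_domain e"
        by (rule edge_domains_cover[of p]) (use p in \<open>auto simp: S_def V_def\<close>)
      show ?thesis
      proof (cases "e \<in> C")
        case True
        have "p \<notin> cycle_trace C" using p inside_no_overlap unfolding S_def by blast
        with True have "p \<notin> convex hull e" by (auto simp: cycle_trace_def)
        then obtain s where s: "p \<in> open_square s" by (rule edge_domain_off_edge[OF e(2)])
        have "?Q y" if "x \<in> open_square s" "y \<in> open_square s" "?Q x" for x y
          using that open_squares_disjoint[OF that(1)] by blast
        moreover have "openin (top_of_set S) (S \<inter> open_square s)"
          by (simp add: openin_open_Int open_open_square)
        ultimately show ?thesis
          using s p by (intro exI[of _ "S \<inter> open_square s"]) blast
      next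
        case False
        have sub: "edge_domain e \<subseteq> inside (cycle_trace C)"
          using p e
          by (intro connected_subset_inside connected_edge_domain edge_domain_misses_cycle C False)
            (auto simp: S_def)
        \<comment> \<open>The domain lies inside the cycle, so each square met in it is an interior square at \<open>e\<close>.\<close>
        have flank: "s \<in> A \<and> e \<in> square_edges s" if x: "x \<in> edge_domain e" "x \<in> open_square s" for x s
        proof -
          have "x \<notin> convex hull e" using open_square_misses_edge[OF e(1)] that by blast
          then obtain s' where s': "e \<in> square_edges s'" "x \<in> open_square s'"
            by (rule edge_domain_off_edge[OF x(1)])
          moreover have "s' = s" using s'(2) that(2) by (rule open_squares_disjoint)
          moreover have "s \<in> A"
            unfolding A_def using that sub by (intro interior_squareI[OF C]) auto
          ultimately show ?thesis by simp
        qed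
        have "?Q y" if "x \<in> edge_domain e" "y \<in> edge_domain e" "?Q x" "y \<in> open_square t" for x y t
        proof -
          obtain s where s: "?step\<^sup>*\<^sup>* q s" "x \<in> open_square s" using \<open>?Q x\<close> by blast
          have "t = s \<or> ?step s t"
            using flank[OF that(1) s(2)] flank[OF that(2,4)] by (auto simp: plus_adjacent_def)
          then have "?step\<^sup>*\<^sup>* q t" using s(1) by (auto intro: rtranclp.rtrancl_into_rtrancl)
          with flank[OF that(2,4)] that(4) show ?thesis by blast
        qed
        moreover have "openin (top_of_set S) (S \<inter> edge_domain e)"
          by (simp add: openin_open_Int open_edge_domain e)
        ultimately show ?thesis
          using p e by (intro exI[of _ "S \<inter> edge_domain e"]) blast
      qed
    qed
  qed
  then have "?step\<^sup>*\<^sup>* q r" using b open_squares_disjoint by blast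
  then show "\<exists>qs. qs \<noteq> [] \<and> hd qs = q \<and> last qs = r \<and> distinct qs \<and>
      set qs \<subseteq> interior_squares C \<and> successively plus_adjacent qs"
    using distinct_walk_of_rtranclp[of A plus_adjacent q r] q unfolding A_def by blast
qed

section \<open>The outermost boundary\<close>

text \<open>
  The outside of \<open>S\<close> is connected, unbounded and misses \<open>T\<close>, so it lies in one unbounded component
  of the complement of \<open>T\<close>.
\<close>

lemma outside_antimono_filled:
  fixes S :: "'a::euclidean_space set"
  assumes "bounded S" "2 \<le> DIM('a)" "T \<subseteq> S \<union> inside S"
  shows "outside S \<subseteq> outside T"
proof
  fix x assume x: "x \<in> outside S"
  have "outside S \<subseteq> - T" using assms(3) by (auto simp: outside_inside)
  then have "outside S \<subseteq> connected_component_set (- T) x"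
    using connected_outside[OF assms(1,2)] x by (intro connected_component_maximal)
  then have "\<not> bounded (connected_component_set (- T) x)"
    using unbounded_outside[OF assms(1)] bounded_subset by blast
  then show "x \<in> outside T" by (simp add: outside)
qed

lemma interior_graph_in_closed_interior:
  assumes "is_cycle lattice_edges C" "e \<in> graph_edges (interior_squares C)"
  shows "convex hull e \<subseteq> cycle_trace C \<union> inside (cycle_trace C)"
proof -
  obtain q where "e \<in> square_edges q" "open_square q \<subseteq> inside (cycle_trace C)"
    using assms(2) by (auto simp: graph_edges_def interior_squares_def)
  then have "convex hull e \<subseteq> closure (inside (cycle_trace C))"
    using edge_in_closure_square closure_mono by blast
  also have "\<dots> \<subseteq> cycle_trace C \<union> inside (cycle_trace C)"
    by (simp add: closure_inside_subset compact_imp_closed compact_cycle_trace[OF assms(1)])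
  finally show ?thesis .
qed

lemma outermost_boundary_interior_squares:
  assumes cyc: "is_cycle lattice_edges C"
  shows "outermost_boundary (interior_squares C) = C"
proof
  have sub: "C \<subseteq> graph_edges (interior_squares C)"
    using cycle_edge_has_interior_square[OF cyc] unfolding graph_edges_def by blast
  with cyc have cyc_in: "is_cycle (graph_edges (interior_squares C)) C"
    by (auto simp: is_cycle_def)
  show "outermost_boundary (interior_squares C) \<subseteq> C"
  proof
    fix e assume e: "e \<in> outermost_boundary (interior_squares C)"
    then obtain q where "e \<in> square_edges q" "q \<in> interior_squares C"
      by (auto simp: outermost_boundary_def graph_edges_def)
    then have "\<not> exterior_edge e C"
      using interior_exterior_disjoint[of C] unfolding exterior_edge_def by blast
    with e cyc_in show "e \<in> C" by (auto simp: outermost_boundary_def)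
  qed
  show "C \<subseteq> outermost_boundary (interior_squares C)"
  proof
    fix e assume e: "e \<in> C"
    have "exterior_edge e C'" if C': "is_cycle (graph_edges (interior_squares C)) C'" "e \<notin> C'" for C'
    proof -
      have lat: "C' \<subseteq> lattice_edges" "e \<in> lattice_edges"
        using is_cycle_subset[OF C'(1)] is_cycle_subset[OF cyc] e unfolding graph_edges_def by blast+
      have "cycle_trace C' \<subseteq> cycle_trace C \<union> inside (cycle_trace C)"
        unfolding cycle_trace_def[of C']
        using is_cycle_subset[OF C'(1)] interior_graph_in_closed_interior[OF cyc] by blast
      then have out: "outside (cycle_trace C) \<subseteq> outside (cycle_trace C')"
        by (intro outside_antimono_filled compact_imp_bounded compact_cycle_trace cyc) auto
      obtain q where q: "e \<in> square_edges q" "q \<in> exterior_squares C"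
        using cycle_edge_has_exterior_square[OF cyc e] .
      then have "edge_domain e \<inter> outside (cycle_trace C') \<noteq> {}"
        using out open_square_nonempty[of q] by (auto simp: edge_domain_def exterior_squares_def)
      then have "edge_domain e \<subseteq> outside (cycle_trace C')"
        by (intro connected_subset_outside connected_edge_domain edge_domain_misses_cycle lat C'(2))
      then show ?thesis
        by (auto simp: exterior_edge_def exterior_squares_def edge_domain_def)
    qed
    then show "e \<in> outermost_boundary (interior_squares C)"
      using e sub by (auto simp: outermost_boundary_def)
  qed
qed

theorem theorem5:
  fixes C :: "edge set"
  assumes "is_cycle lattice_edges C"
  shows "finite (interior_squares C) \<and>
         plus_connected (interior_squares C) \<and>
         outermost_boundary (interior_squares C) = C"
  using finite_interior_squares[OF assms] plus_connected_interior_squares[OF assms]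
    outermost_boundary_interior_squares[OF assms] by blast

end
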